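(* There exist a constant $c > 0$ and $N \in \mathbb{N}$ such that for all integers $n \geq N$ and all real $t > 0$, $$|F_n(t)| < \frac{c}{n^{1/12}} .$$ In particular, for all $t > 0$, $$\lim_{n \to \infty} |F_n(t)| = 0 .$$
   Context: The functions $F_k$ ($k \in \{0,1,2,\ldots\}$, called Bateman functions) are defined for $t \geq 0$ as the Taylor coefficients, for $z$ in the open unit disk of $\mathbb{C}$, in the generating function $$e^{-t\,\frac{1+z}{1-z}} = \sum_{k=0}^{\infty} F_k(t)\, z^k .$$ *)

theory Defs
  imports "HOL-Complex_Analysis.Complex_Analysis"
begin

definition bateman_gf :: "real \<Rightarrow> complex \<Rightarrow> complex" where
  "bateman_gf t z = exp (- (of_real t * ((1 + z) / (1 - z))))"

text \<open>
  The Taylor coefficients are taken in the complex numbers; \<open>bateman_in_Reals\<close> below shows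
  that they are real, so that \<open>norm (bateman k t)\<close> is the usual absolute value.
\<close>
definition bateman :: "nat \<Rightarrow> real \<Rightarrow> complex" where
  "bateman k t = fps_nth (fps_expansion (bateman_gf t) 0) k"

lemma bateman_gf_holomorphic: "bateman_gf t holomorphic_on ball 0 1"
  unfolding bateman_gf_def by (intro holomorphic_intros) auto

lemma bateman_sums:
  assumes "norm z < 1"
  shows "(\<lambda>k. bateman k t * z ^ k) sums exp (- (of_real t * ((1 + z) / (1 - z))))"
  using holomorphic_power_series[OF bateman_gf_holomorphic, of z t] assms
  by (simp add: bateman_def fps_expansion_def bateman_gf_def)

lemma bateman_unique:
  assumes "\<And>z. norm z < 1 \<Longrightarrow> (\<lambda>k. a k * z ^ k) sums exp (- (of_real t * ((1 + z) / (1 - z))))"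
  shows "a k = bateman k t"
proof -
  have "eventually (\<lambda>z. z \<in> ball (0::complex) 1) (nhds 0)"
    by (rule eventually_nhds_in_open) auto
  then have "eventually (\<lambda>z. (\<lambda>k. fps_nth (Abs_fps a) k * z ^ k) sums bateman_gf t z) (nhds 0)"
    by eventually_elim (use assms in \<open>simp add: bateman_gf_def\<close>)
  then have "fps_expansion (bateman_gf t) 0 = Abs_fps a"
    by (intro fps_expansion_eqI has_fps_expansionI)
  then show ?thesis
    by (simp add: bateman_def)
qed

lemma bateman_in_Reals: "bateman k t \<in> \<real>"
proof -
  have "cnj (bateman k t) = bateman k t"
  proof (rule bateman_unique[where a = "\<lambda>k. cnj (bateman k t)"])
    fix z :: complex
    assume "norm z < 1"
    then have "(\<lambda>k. bateman k t * cnj z ^ k) sums exp (- (of_real t * ((1 + cnj z) / (1 - cnj z))))"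
      by (intro bateman_sums) simp
    then have "(\<lambda>k. cnj (bateman k t * cnj z ^ k)) sums
        cnj (exp (- (of_real t * ((1 + cnj z) / (1 - cnj z)))))"
      by (subst sums_cnj)
    then show "(\<lambda>k. cnj (bateman k t) * z ^ k) sums exp (- (of_real t * ((1 + z) / (1 - z))))"
      by (simp add: exp_cnj)
  qed
  then show ?thesis
    by (simp add: Reals_cnj_iff)
qed

end

theory Submission
  imports Defs
begin

text \<open>
  Letting the radius in Cauchy's formula tend to \<open>1\<close> gives
  \<open>F\<^sub>n(t) = \<integral>\<^sub>0\<^sup>1 exp (-i f(x)) dx\<close> with phase \<open>f(x) = t cot (\<pi> x) + 2 \<pi> n x\<close>, and by the symmetry
  \<open>x \<mapsto> 1 - x\<close> it suffices to bound the integral over \<open>[0, 1/2]\<close>, where \<open>f\<close> is convex. Put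
  \<open>s = n\<^sup>1\<^sup>/\<^sup>1\<^sup>2\<close>. If \<open>t \<le> s\<^sup>6\<close>, then \<open>f' \<ge> n\<close> as soon as \<open>x \<ge> 1/s\<close>, and the integral is small by
  the first-derivative test. If \<open>t \<ge> s\<^sup>6\<close>, then \<open>f''\<close> is at least of order \<open>t/s\<close> at
  distance \<open>1/s\<close> from the inflection point \<open>x = 1/2\<close>, and van der Corput's second-derivative
  test applies. In both cases the discarded intervals contribute \<open>O(1/s)\<close>.
\<close>

section \<open>Integral representation on the unit circle\<close>

text \<open>The Cayley transform \<open>(1 + z) / (1 - z)\<close> sends the open unit disk into the
  right half-plane, so the exponent has nonpositive real part. This supplies the dominating bound
  when the radius tends to 1.\<close>

lemma bateman_gf_norm_le_1:
  assumes "t \<ge> 0" "norm z < 1"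
  shows "norm (bateman_gf t z) \<le> 1"
proof -
  have "Re ((1 + z) / (1 - z)) = (1 - (norm z)\<^sup>2) / ((1 - Re z)\<^sup>2 + (Im z)\<^sup>2)"
    by (simp add: Re_divide cmod_power2) (simp add: algebra_simps power2_eq_square)
  also have "\<dots> \<ge> 0"
    using assms by (intro divide_nonneg_nonneg) (auto simp: power_le_one)
  finally have "Re (of_real t * ((1 + z) / (1 - z))) \<ge> 0"
    using assms by (simp only: Re_complex_of_real Im_complex_of_real times_complex.sel) simp
  then show ?thesis
    by (simp only: bateman_gf_def norm_exp_eq_Re uminus_complex.sel) simp
qed

text \<open>Pulling \<open>cis y\<close> out of numerator and denominator leaves
  \<open>2 cos y\<close> and \<open>-2 i sin y\<close>. On the unit circle the generating function
  is therefore purely oscillatory, and this is the source of the cotangent in the phase.\<close>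

lemma cayley_cis_eq_cot:
  assumes "sin y \<noteq> 0"
  shows "(1 + cis (2 * y)) / (1 - cis (2 * y)) = \<i> * of_real (cot y)"
proof -
  have c: "cis (2 * y) = cis y * cis y"
    by (simp add: cis_mult)
  have i: "1 = cis y * cis (- y)"
    by (simp add: cis_mult)
  have "1 + cis (2 * y) = cis y * (2 * of_real (cos y))"
    unfolding c by (subst i, simp only: distrib_left [symmetric]) (simp add: complex_eq_iff)
  moreover have "1 - cis (2 * y) = cis y * (- 2 * \<i> * of_real (sin y))"
    unfolding c by (subst i, simp only: right_diff_distrib [symmetric]) (simp add: complex_eq_iff)
  ultimately show ?thesis
    using assms by (simp only:) (simp add: cot_def divide_simps)
qed

text \<open>Cauchy's coefficient formula on the circle of radius \<open>r\<close>, parametrised by a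
  full turn: \<open>2 pi i u\<close> from \<open>du\<close> cancels one of the \<open>n + 1\<close>
  factors in the denominator and the prefactor.\<close>

lemma bateman_integral_circle:
  assumes "0 < r" "r < 1"
  shows "((\<lambda>x. bateman_gf t (of_real r * cis (2 * pi * x)) * cis (- (2 * pi * n * x)) / of_real r ^ n)
    has_integral bateman n t) {0..1}"
proof -
  have "((\<lambda>u. bateman_gf t u / (u - 0) ^ Suc n) has_contour_integral
      (2 * pi * \<i>) / fact n * (deriv ^^ n) (bateman_gf t) 0) (circlepath 0 r)"
  proof (rule Cauchy_has_contour_integral_higher_derivative_circlepath)
    have "cball 0 r \<subseteq> ball (0::complex) 1"
      using assms by auto
    then have "bateman_gf t holomorphic_on cball 0 r"
      using bateman_gf_holomorphic holomorphic_on_subset by blast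
    then show "continuous_on (cball 0 r) (bateman_gf t)" "bateman_gf t holomorphic_on ball 0 r"
      using holomorphic_on_imp_continuous_on holomorphic_on_subset ball_subset_cball by blast+
  qed (use assms in auto)
  also have "(2 * pi * \<i>) / fact n * (deriv ^^ n) (bateman_gf t) 0 = 2 * pi * \<i> * bateman n t"
    by (simp add: bateman_def fps_expansion_def)
  finally have "((\<lambda>x. bateman_gf t (circlepath 0 r x) / circlepath 0 r x ^ Suc n *
      vector_derivative (circlepath 0 r) (at x)) has_integral 2 * pi * \<i> * bateman n t) {0..1}"
    by (simp add: has_contour_integral)
  moreover have "circlepath 0 r = (\<lambda>x. of_real r * cis (2 * pi * x))"
    by (auto simp: circlepath cis_conv_exp mult_ac)
  moreover have "vector_derivative (circlepath 0 r) (at x) = 2 * pi * \<i> * (of_real r * cis (2 * pi * x))" for x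
    by (simp add: vector_derivative_circlepath cis_conv_exp mult_ac)
  ultimately have "((\<lambda>x. bateman_gf t (of_real r * cis (2 * pi * x)) / (of_real r * cis (2 * pi * x)) ^ Suc n
      * (2 * pi * \<i> * (of_real r * cis (2 * pi * x)))) has_integral 2 * pi * \<i> * bateman n t) {0..1}"
    by simp
  then have "((\<lambda>x. 1 / (2 * pi * \<i>) * (bateman_gf t (of_real r * cis (2 * pi * x)) /
      (of_real r * cis (2 * pi * x)) ^ Suc n * (2 * pi * \<i> * (of_real r * cis (2 * pi * x)))))
      has_integral 1 / (2 * pi * \<i>) * (2 * pi * \<i> * bateman n t)) {0..1}"
    by (rule has_integral_mult_right)
  moreover have "1 / (2 * pi * \<i>) * (2 * pi * \<i> * bateman n t) = bateman n t"
    by simp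
  moreover have "1 / (2 * pi * \<i>) * (bateman_gf t (of_real r * cis (2 * pi * x)) /
      (of_real r * cis (2 * pi * x)) ^ Suc n * (2 * pi * \<i> * (of_real r * cis (2 * pi * x)))) =
      bateman_gf t (of_real r * cis (2 * pi * x)) * cis (- (2 * pi * n * x)) / of_real r ^ n" for x
  proof -
    have "cis (- (2 * pi * n * x)) = inverse (cis (2 * pi * x) ^ n)"
      unfolding Complex.DeMoivre cis_inverse by (simp add: mult_ac)
    then show ?thesis
      using assms by (simp only:) (simp add: power_mult_distrib divide_simps)
  qed
  ultimately show ?thesis
    by (simp only:)
qed

lemma bateman_has_integral:
  assumes "t \<ge> 0"
  shows "((\<lambda>x. cis (- (t * cot (pi * x) + 2 * pi * n * x))) has_integral bateman n t) {0..1}"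
proof -
  \<comment> \<open>The shift by 2 makes \<open>r 0 = 1/2\<close>, so the factors
    \<open>1 / r k ^ n\<close> are dominated by \<open>2 ^ n\<close> for every
    \<open>k\<close>.\<close>
  define r where "r k = 1 - 1 / (real k + 2)" for k
  have r: "1 / 2 \<le> r k" "r k < 1" for k
    by (auto simp: r_def field_simps)
  have "r \<longlonglongrightarrow> 1"
    unfolding r_def by real_asymp
  define g where
    "g \<rho> x = bateman_gf t (of_real \<rho> * cis (2 * pi * x)) * cis (- (2 * pi * n * x)) / of_real \<rho> ^ n" for \<rho> x
  \<comment> \<open>The endpoints are removed because both correspond to the singularity
    \<open>z = 1\<close>: for \<open>t > 0\<close> the integrands tend to 0 there, whereas the
    default value 0 of \<open>cot\<close> makes the claimed limit 1.\<close>
  have "((\<lambda>x. cis (- (t * cot (pi * x) + 2 * pi * n * x))) has_integral bateman n t) {0<..<1}"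
  proof (rule has_integral_dominated_convergence[where f = "\<lambda>k. g (r k)" and y = "\<lambda>_. bateman n t"
        and h = "\<lambda>_. 2 ^ n"])
    show "(g (r k) has_integral bateman n t) {0<..<1}" for k
      using bateman_integral_circle[of "r k" t n] r[of k] 
      by (simp add: g_def[abs_def] has_integral_Icc_iff_Ioo)
    show "(\<lambda>_::real. 2 ^ n :: real) integrable_on {0<..<1}"
      using integrable_on_Icc_iff_Ioo integrable_const_ivl by blast
    show "\<forall>x\<in>{0<..<1}. norm (g (r k) x) \<le> 2 ^ n" for k
    proof
      fix x :: real
      have "norm (bateman_gf t (of_real (r k) * cis (2 * pi * x))) \<le> 1"
        using assms r[of k] by (intro bateman_gf_norm_le_1) (auto simp: norm_mult)
      then have "norm (g (r k) x) \<le> 1 / r k ^ n"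
        using r[of k] by (simp add: g_def norm_divide norm_mult norm_power divide_right_mono)
      also have "\<dots> \<le> 1 / (1 / 2) ^ n"
        using r[of k] by (intro divide_left_mono power_mono) auto
      finally show "norm (g (r k) x) \<le> 2 ^ n"
        by (simp add: power_divide)
    qed
    show "\<forall>x\<in>{0<..<1}. (\<lambda>k. g (r k) x) \<longlonglongrightarrow> cis (- (t * cot (pi * x) + 2 * pi * n * x))"
    proof
      fix x :: real
      assume x: "x \<in> {0<..<1}"
      then have s: "sin (pi * x) > 0"
        by (intro sin_gt_zero) auto
      have c: "cis (2 * pi * x) \<noteq> 1"
      proof
        assume "cis (2 * pi * x) = 1"
        then have "cos (2 * (pi * x)) = 1"
          by (simp add: complex_eq_iff mult_ac)
        then show False
          using s by (simp add: cos_double_sin)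
      qed
      have "(\<lambda>k. g (r k) x) \<longlonglongrightarrow> g 1 x"
        unfolding g_def bateman_gf_def using c \<open>r \<longlonglongrightarrow> 1\<close> by (auto intro!: tendsto_eq_intros)
      also have "g 1 x = cis (- (t * cot (pi * x) + 2 * pi * n * x))"
      proof -
        have "(1 + cis (2 * pi * x)) / (1 - cis (2 * pi * x)) = \<i> * of_real (cot (pi * x))"
          using cayley_cis_eq_cot[of "pi * x"] s by (simp add: mult.assoc)
        then show ?thesis
          by (simp add: g_def bateman_gf_def cis_conv_exp exp_add [symmetric] algebra_simps)
      qed
      finally show "(\<lambda>k. g (r k) x) \<longlonglongrightarrow> cis (- (t * cot (pi * x) + 2 * pi * n * x))" .
    qed
  qed auto
  then show ?thesis
    by (simp add: has_integral_Icc_iff_Ioo)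
qed

section \<open>Oscillatory integrals with convex phase\<close>

text \<open>The integrand is the derivative of \<open>arctan (f' x / \<mu>) / \<mu>\<close>. As
  \<open>arctan\<close> is bounded, its integral is at most \<open>pi / \<mu>\<close> however large
  \<open>f'\<close> becomes.\<close>

lemma has_integral_arctan_kernel:
  fixes f' f'' :: "real \<Rightarrow> real"
  assumes "a \<le> b" "\<mu> > 0"
    and f': "\<And>x. x \<in> {a..b} \<Longrightarrow> (f' has_real_derivative f'' x) (at x within {a..b})"
  shows "((\<lambda>x. f'' x / ((f' x)\<^sup>2 + \<mu>\<^sup>2)) has_integral
    (arctan (f' b / \<mu>) / \<mu> - arctan (f' a / \<mu>) / \<mu>)) {a..b}"
proof (rule fundamental_theorem_of_calculus[OF \<open>a \<le> b\<close>])
  fix x assume x: "x \<in> {a..b}"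
  have "(f' x)\<^sup>2 + \<mu>\<^sup>2 > 0"
    using \<open>\<mu> > 0\<close> by (intro add_nonneg_pos) auto
  then show "((\<lambda>x. arctan (f' x / \<mu>) / \<mu>) has_vector_derivative f'' x / ((f' x)\<^sup>2 + \<mu>\<^sup>2)) (at x within {a..b})"
    unfolding has_real_derivative_iff_has_vector_derivative [symmetric]
    using \<open>\<mu> > 0\<close>
    by (auto intro!: derivative_eq_intros f'[OF x] simp: power2_eq_square divide_simps)
qed

lemma arctan_diff_le:
  fixes \<mu> :: real
  assumes "\<mu> > 0"
  shows "arctan x / \<mu> - arctan y / \<mu> \<le> pi / \<mu>"
  using arctan_ubound[of x] arctan_lbound[of y] assms
  by (simp add: diff_divide_distrib [symmetric] divide_right_mono)

lemma continuous_on_square_kernel: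
  fixes g :: "real \<Rightarrow> real"
  assumes "continuous_on S g" "\<mu> > 0"
  shows "continuous_on S (\<lambda>x. \<mu>\<^sup>2 / ((g x)\<^sup>2 + \<mu>\<^sup>2))"
  using assms by (intro continuous_intros) (auto simp: sum_power2_eq_zero_iff)

text \<open>
  A first-derivative test that tolerates zeros of \<open>f'\<close>: instead of integrating \<open>cis f\<close> by parts
  against \<open>1 / f'\<close>, use the regularisation \<open>f' / (f'\<^sup>2 + \<mu>\<^sup>2)\<close>. All error terms are then
  controlled by the total variation of \<open>arctan (f' / \<mu>)\<close>.
\<close>
lemma norm_integral_cis_le:
  fixes f f' f'' :: "real \<Rightarrow> real"
  assumes "a \<le> b" "\<mu> > 0"
    and f: "\<And>x. x \<in> {a..b} \<Longrightarrow> (f has_real_derivative f' x) (at x within {a..b})"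
    and f': "\<And>x. x \<in> {a..b} \<Longrightarrow> (f' has_real_derivative f'' x) (at x within {a..b})"
    and convex: "\<And>x. x \<in> {a..b} \<Longrightarrow> f'' x \<ge> 0"
  shows "norm (integral {a..b} (\<lambda>x. cis (f x)))
    \<le> (1 + pi) / \<mu> + integral {a..b} (\<lambda>x. \<mu>\<^sup>2 / ((f' x)\<^sup>2 + \<mu>\<^sup>2))"
proof -
  define q where "q x = (f' x)\<^sup>2 + \<mu>\<^sup>2" for x
  have q: "q x > 0" for x
    unfolding q_def using \<open>\<mu> > 0\<close> by (intro add_nonneg_pos) auto
  \<comment> \<open>\<open>w\<close> is the regularised reciprocal of \<open>f'\<close> and
    \<open>h\<close> the boundary term of the integration by parts. The derivative \<open>h'\<close>
    reproduces \<open>cis f\<close> up to the factor \<open>1 - w f' + i w'\<close>, and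
    \<open>1 - w f'\<close> equals \<open>\<mu>\<^sup>2 / q\<close>.\<close>
  define w w' where "w x = f' x / q x" and "w' x = f'' x * (\<mu>\<^sup>2 - (f' x)\<^sup>2) / (q x)\<^sup>2" for x
  define h h' where "h x = - \<i> * of_real (w x) * cis (f x)"
    and "h' x = of_real (w x * f' x) * cis (f x) - \<i> * of_real (w' x) * cis (f x)" for x
  have qd: "(q has_real_derivative (2 * f' x * f'' x)) (at x within {a..b})" if "x \<in> {a..b}" for x
    unfolding q_def using f'[OF that] by (auto intro!: derivative_eq_intros)
  have wd: "(w has_real_derivative w' x) (at x within {a..b})" if "x \<in> {a..b}" for x
    unfolding w_def w'_def using q[of x]
    by (auto intro!: derivative_eq_intros f'[OF that] qd[OF that])
       (simp add: q_def power2_eq_square algebra_simps divide_simps)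
  have cd: "((\<lambda>x. cis (f x)) has_vector_derivative f' x *\<^sub>R (\<i> * cis (f x))) (at x within {a..b})"
    if "x \<in> {a..b}" for x
    using has_derivative_cis[OF f[OF that, unfolded has_field_derivative_def]]
    by (simp add: has_vector_derivative_def mult_ac)
  have hd: "(h has_vector_derivative h' x) (at x within {a..b})" if "x \<in> {a..b}" for x
  proof -
    show ?thesis
      unfolding h_def h'_def mult.assoc
      by (auto intro!: derivative_eq_intros cd[OF that] wd[OF that] simp: scaleR_conv_of_real algebra_simps)
  qed
  have I_h': "(h' has_integral (h b - h a)) {a..b}"
    using \<open>a \<le> b\<close> hd by (rule fundamental_theorem_of_calculus)
  \<comment> \<open>By the inequality of arithmetic and geometric means,
    \<open>2 \<mu> \<bar>f'\<bar> \<le> q\<close>; the two endpoints together cost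
    \<open>1 / \<mu>\<close>.\<close>
  have norm_h: "norm (h x) \<le> 1 / (2 * \<mu>)" for x
  proof -
    have "\<bar>f' x\<bar> * (2 * \<mu>) \<le> q x"
      using zero_le_power2[of "\<bar>f' x\<bar> - \<mu>"] by (simp add: q_def power2_eq_square algebra_simps)
    moreover have "norm (h x) = \<bar>f' x\<bar> / q x"
      using q[of x] unfolding h_def norm_mult norm_of_real by (simp add: w_def)
    ultimately show ?thesis
      using q[of x] \<open>\<mu> > 0\<close> by (simp only:) (simp add: field_simps)
  qed
  define p where "p x = \<mu>\<^sup>2 / q x" for x
  have I_p: "p integrable_on {a..b}"
    unfolding p_def[abs_def] q_def[abs_def]
    by (rule integrable_continuous_real[OF continuous_on_square_kernel[OF DERIV_continuous_on[OF f'] \<open>\<mu> > 0\<close>]])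
  note I_a = has_integral_arctan_kernel[OF assms(1,2) f', folded q_def]
  have "(\<lambda>x. cis (f x)) integrable_on {a..b}"
    using cd by (intro integrable_continuous_real continuous_on_vector_derivative)
  then have I: "((\<lambda>x. cis (f x) - h' x) has_integral (integral {a..b} (\<lambda>x. cis (f x)) - (h b - h a))) {a..b}"
    by (intro has_integral_diff I_h') (simp add: integrable_integral)
  have "norm (cis (f x) - h' x) \<le> p x + f'' x / q x" if "x \<in> {a..b}" for x
  proof -
    have "cis (f x) - h' x = (of_real (1 - w x * f' x) + \<i> * of_real (w' x)) * cis (f x)"
      by (simp add: h'_def algebra_simps)
    also have "1 - w x * f' x = p x"
      using q[of x] by (simp add: w_def p_def field_simps) (simp add: q_def power2_eq_square)
    finally have "norm (cis (f x) - h' x) \<le> \<bar>p x\<bar> + \<bar>w' x\<bar>"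
      by (simp add: norm_mult) (metis norm_triangle_ineq norm_mult norm_ii norm_of_real mult_1)
    \<comment> \<open>Convexity enters here: since \<open>f''\<close> is nonnegative,
      \<open>w'\<close> is dominated by the arctan kernel itself, without an absolute value on
      \<open>f''\<close>.\<close>
    also have "\<bar>w' x\<bar> \<le> f'' x / q x"
    proof -
      have "\<bar>\<mu>\<^sup>2 - (f' x)\<^sup>2\<bar> \<le> q x"
        by (auto simp: q_def abs_le_iff)
      then have "\<bar>w' x\<bar> \<le> f'' x * q x / (q x)\<^sup>2"
        using convex[OF that] q[of x] by (auto simp: w'_def abs_mult intro!: divide_right_mono mult_left_mono)
      then show ?thesis
        using q[of x] by (simp add: power2_eq_square)
    qed
    also have "\<bar>p x\<bar> = p x"
      using q[of x] by (simp add: p_def)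
    finally show ?thesis by simp
  qed
  then have "norm (integral {a..b} (\<lambda>x. cis (f x)) - (h b - h a))
      \<le> integral {a..b} p + (arctan (f' b / \<mu>) / \<mu> - arctan (f' a / \<mu>) / \<mu>)"
    using integral_norm_bound_integral[OF has_integral_integrable[OF I]
       has_integral_integrable[OF has_integral_add[OF integrable_integral[OF I_p] I_a]]]
       integral_unique[OF I] integral_unique[OF has_integral_add[OF integrable_integral[OF I_p] I_a]]
    by simp
  moreover have "arctan (f' b / \<mu>) / \<mu> - arctan (f' a / \<mu>) / \<mu> \<le> pi / \<mu>"
    by (rule arctan_diff_le[OF \<open>\<mu> > 0\<close>])
  moreover have "norm (h b - h a) \<le> 1 / \<mu>"
    using norm_triangle_ineq4[of "h b" "h a"] norm_h[of a] norm_h[of b] by simp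
  moreover have "norm (integral {a..b} (\<lambda>x. cis (f x)))
      \<le> norm (integral {a..b} (\<lambda>x. cis (f x)) - (h b - h a)) + norm (h b - h a)"
    by (metis diff_add_cancel norm_triangle_ineq)
  ultimately show ?thesis
    by (simp add: p_def[abs_def] q_def add_divide_distrib)
qed

text \<open>The lower bound on \<open>f''\<close> gives \<open>1 \<le> f'' / \<kappa>\<close>, so
  the remaining integral in \<open>norm_integral_cis_le\<close> is also dominated by a multiple of
  the arctan kernel. Taking \<open>\<mu>\<close> as the square root of \<open>\<kappa>\<close> would
  give van der Corput's bound; \<open>\<mu>\<close> is left free.\<close>

lemma norm_integral_cis_le_second_derivative:
  fixes f f' f'' :: "real \<Rightarrow> real"
  assumes "a \<le> b" "\<mu> > 0" "\<kappa> > 0"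
    and f: "\<And>x. x \<in> {a..b} \<Longrightarrow> (f has_real_derivative f' x) (at x within {a..b})"
    and f': "\<And>x. x \<in> {a..b} \<Longrightarrow> (f' has_real_derivative f'' x) (at x within {a..b})"
    and ge: "\<And>x. x \<in> {a..b} \<Longrightarrow> f'' x \<ge> \<kappa>"
  shows "norm (integral {a..b} (\<lambda>x. cis (f x))) \<le> (1 + pi) / \<mu> + pi * \<mu> / \<kappa>"
proof -
  note I = has_integral_mult_right[OF has_integral_arctan_kernel[OF assms(1,2) f'], where c = "\<mu>\<^sup>2 / \<kappa>"]
  have q: "(f' x)\<^sup>2 + \<mu>\<^sup>2 > 0" for x
    using \<open>\<mu> > 0\<close> by (intro add_nonneg_pos) auto
  have "(\<lambda>x. \<mu>\<^sup>2 / ((f' x)\<^sup>2 + \<mu>\<^sup>2)) integrable_on {a..b}"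
    by (rule integrable_continuous_real[OF continuous_on_square_kernel[OF DERIV_continuous_on[OF f'] \<open>\<mu> > 0\<close>]])
  then have "integral {a..b} (\<lambda>x. \<mu>\<^sup>2 / ((f' x)\<^sup>2 + \<mu>\<^sup>2))
      \<le> \<mu>\<^sup>2 / \<kappa> * (arctan (f' b / \<mu>) / \<mu> - arctan (f' a / \<mu>) / \<mu>)"
  proof (rule has_integral_le[OF integrable_integral I])
    fix x assume "x \<in> {a..b}"
    then have "\<mu>\<^sup>2 * 1 \<le> \<mu>\<^sup>2 * (f'' x / \<kappa>)"
      using ge \<open>\<kappa> > 0\<close> by (intro mult_left_mono) auto
    then show "\<mu>\<^sup>2 / ((f' x)\<^sup>2 + \<mu>\<^sup>2) \<le> \<mu>\<^sup>2 / \<kappa> * (f'' x / ((f' x)\<^sup>2 + \<mu>\<^sup>2))"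
      using divide_right_mono[of _ _ "(f' x)\<^sup>2 + \<mu>\<^sup>2"] q[of x] by (fastforce simp: less_imp_le)
  qed
  also have "\<dots> \<le> \<mu>\<^sup>2 / \<kappa> * (pi / \<mu>)"
    using assms by (intro mult_left_mono arctan_diff_le) auto
  also have "\<dots> = pi * \<mu> / \<kappa>"
    using assms by (simp add: power2_eq_square)
  finally show ?thesis
    using norm_integral_cis_le[OF assms(1,2) f f'] ge \<open>\<kappa> > 0\<close> by fastforce
qed

section \<open>The Bateman phase: symmetry, derivatives and convexity\<close>

definition phase :: "nat \<Rightarrow> real \<Rightarrow> real \<Rightarrow> real" where
  "phase n t x = t * cot (pi * x) + 2 * pi * n * x"

text \<open>Since \<open>phase n t (1 - x) = 2 * pi * n - phase n t x\<close>, reflection at 1/2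
  conjugates the integrand. The two halves are thus complex conjugates of each other and have equal
  norm.\<close>

lemma bateman_eq_half_integrals:
  assumes "t \<ge> 0"
  shows "(\<lambda>x. cis (phase n t x)) integrable_on {0..1/2}"
    and "norm (bateman n t) \<le> 2 * norm (integral {0..1/2} (\<lambda>x. cis (phase n t x)))"
proof -
  define g where "g x = cis (- phase n t x)" for x
  have I: "(g has_integral bateman n t) {0..1}"
    using bateman_has_integral[OF assms, of n] unfolding g_def[abs_def] phase_def .
  have I1: "(g has_integral integral {0..1/2} g) {0..1/2}" 
    and I2: "(g has_integral integral {1/2..1} g) {1/2..1}"
    using integrable_on_subinterval[OF has_integral_integrable[OF I]] by (auto intro!: integrable_integral)
  have cnj_g: "cis (phase n t x) = cnj (g x)" for x
    by (simp add: g_def cis_cnj)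
  show "(\<lambda>x. cis (phase n t x)) integrable_on {0..1/2}"
    using has_integral_integrable[OF has_integral_cnj[THEN iffD2, OF I1]] by (simp only: cnj_g o_def)
  have "integral {0..1/2} (\<lambda>x. cis (phase n t x)) = cnj (integral {0..1/2} g)"
    unfolding cnj_g by (rule Henstock_Kurzweil_Integration.integral_cnj [symmetric])
  then have norm_eq: "norm (integral {0..1/2} g) = norm (integral {0..1/2} (\<lambda>x. cis (phase n t x)))"
    by simp
  have reflect: "g (1 - x) = cis (phase n t x)" for x
  proof -
    have "phase n t (1 - x) = 2 * pi * n - phase n t x"
      by (simp add: phase_def cot_def algebra_simps)
    then show ?thesis
      by (simp add: g_def cis_divide [symmetric] cis_multiple_2pi)
  qed
  have "((\<lambda>x. g (1 - x)) has_integral integral {1/2..1} g) {0..1/2}"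
    using has_integral_affinity[OF I2[folded cbox_interval], of "-1" 1]
    by (simp add: image_affinity_atLeastAtMost)
  then have I2': "integral {0..1/2} (\<lambda>x. cis (phase n t x)) = integral {1/2..1} g"
    unfolding reflect by (rule integral_unique)
  have "(g has_integral (integral {0..1/2} g + integral {1/2..1} g)) {0..1}"
    by (rule has_integral_combine[OF _ _ I1 I2]) auto
  then have "bateman n t = integral {0..1/2} g + integral {1/2..1} g"
    by (rule has_integral_unique[OF I])
  then show "norm (bateman n t) \<le> 2 * norm (integral {0..1/2} (\<lambda>x. cis (phase n t x)))"
    using norm_triangle_ineq[of "integral {0..1/2} g" "integral {1/2..1} g"] norm_eq
    unfolding I2' by simp
qed

text \<open>The integrand has norm 1, so cutting off an end piece costs at most its length. This
  removes neighbourhoods of the singularity at 0 and of the inflection point at 1/2.\<close>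

lemma norm_integral_cis_split:
  fixes a b \<alpha> \<beta> :: real
  assumes "(\<lambda>x. cis (f x)) integrable_on {a..b}" "a \<le> \<alpha>" "\<alpha> \<le> \<beta>" "\<beta> \<le> b"
  shows "norm (integral {a..b} (\<lambda>x. cis (f x)))
    \<le> (\<alpha> - a) + norm (integral {\<alpha>..\<beta>} (\<lambda>x. cis (f x))) + (b - \<beta>)"
proof -
  let ?I = "\<lambda>u v. integral {u..v} (\<lambda>x. cis (f x))"
  have int: "(\<lambda>x. cis (f x)) integrable_on {u..v}" if "a \<le> u" "v \<le> b" for u v
    using integrable_on_subinterval[OF assms(1)] that by auto
  have bound: "norm (?I u v) \<le> v - u" if "a \<le> u" "u \<le> v" "v \<le> b" for u v
    using integral_norm_bound_integral[OF int[of u v] integrable_const_ivl[of 1]] that by simp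
  have "?I a b = ?I a \<alpha> + ?I \<alpha> \<beta> + ?I \<beta> b"
    using Henstock_Kurzweil_Integration.integral_combine[of a \<alpha> b, OF _ _ int]
      Henstock_Kurzweil_Integration.integral_combine[of \<alpha> \<beta> b, OF _ _ int] assms
    by (simp add: add.assoc)
  moreover have "norm (?I a \<alpha>) \<le> \<alpha> - a" "norm (?I \<beta> b) \<le> b - \<beta>"
    using assms by (auto intro!: bound)
  ultimately show ?thesis
    using norm_triangle_ineq[of "?I a \<alpha> + ?I \<alpha> \<beta>" "?I \<beta> b"] norm_triangle_ineq[of "?I a \<alpha>" "?I \<alpha> \<beta>"]
    by (simp only:)
qed

text \<open>Jordan's inequality: the concave sine lies above its chord from 0 to
  \<open>pi / 2\<close>.\<close>

lemma sin_pi_mult_ge: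
  fixes x :: real
  assumes "0 \<le> x" "x \<le> 1/2"
  shows "sin (pi * x) \<ge> 2 * x"
proof -
  have "concave_on {0..pi} (sin :: real \<Rightarrow> real)"
    by (rule f''_le0_imp_concave[where f' = cos and f'' = "\<lambda>x. - sin x"])
       (auto intro!: derivative_eq_intros sin_ge_zero)
  then have "(1 - 2 * x) * sin 0 + 2 * x * sin (pi / 2) \<le> sin ((1 - 2 * x) *\<^sub>R 0 + (2 * x) *\<^sub>R (pi / 2))"
    using assms by (intro concave_onD) auto
  then show ?thesis
    by (simp add: mult.commute)
qed

definition phase' :: "nat \<Rightarrow> real \<Rightarrow> real \<Rightarrow> real" where
  "phase' n t x = 2 * pi * n - pi * t / (sin (pi * x))\<^sup>2"

definition phase'' :: "real \<Rightarrow> real \<Rightarrow> real" where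
  "phase'' t x = 2 * pi\<^sup>2 * t * cos (pi * x) / (sin (pi * x)) ^ 3"

lemma
  assumes "0 < x" "x < 1"
  shows has_derivative_phase: "(phase n t has_real_derivative phase' n t x) (at x within S)"
    and has_derivative_phase': "(phase' n t has_real_derivative phase'' t x) (at x within S)"
proof -
  have s: "sin (pi * x) > 0"
    using assms by (intro sin_gt_zero) auto
  have "((\<lambda>x. cot (pi * x)) has_real_derivative (- inverse ((sin (pi * x))\<^sup>2) * pi)) (at x within S)"
    using s by (intro DERIV_chain2[OF DERIV_cot]) (auto intro!: derivative_eq_intros)
  then show "(phase n t has_real_derivative phase' n t x) (at x within S)"
    unfolding phase_def[abs_def] phase'_def
    by (auto intro!: derivative_eq_intros simp: divide_inverse)
  show "(phase' n t has_real_derivative phase'' t x) (at x within S)"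
    unfolding phase'_def[abs_def] phase''_def using s
    by (auto intro!: derivative_eq_intros simp: power2_eq_square power3_eq_cube field_simps)
qed

text \<open>The cubed sine in the denominator is at most 1, and Jordan's inequality applied to
  \<open>1/2 - x\<close> bounds the cosine from below. The estimate decays linearly towards the
  inflection point and does not involve \<open>n\<close>.\<close>

lemma phase''_ge:
  assumes "t \<ge> 0" "0 < x" "x \<le> 1/2"
  shows "phase'' t x \<ge> 4 * pi\<^sup>2 * t * (1/2 - x)"
proof -
  have s: "sin (pi * x) > 0"
    using assms by (intro sin_gt_zero) auto
  have "cos (pi * x) = sin (pi * (1/2 - x))"
    by (simp add: cos_sin_eq algebra_simps)
  then have c: "cos (pi * x) \<ge> 2 * (1/2 - x)"
    using sin_pi_mult_ge[of "1/2 - x"] assms by simp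
  have "4 * pi\<^sup>2 * t * (1/2 - x) = 2 * pi\<^sup>2 * t * (2 * (1/2 - x))"
    by simp
  also have "\<dots> \<le> 2 * pi\<^sup>2 * t * cos (pi * x)"
    using c assms by (intro mult_left_mono) auto
  also have "\<dots> \<le> 2 * pi\<^sup>2 * t * cos (pi * x) / 1"
    by simp
  also have "\<dots> \<le> phase'' t x"
    unfolding phase''_def using s c assms
    by (intro divide_left_mono mult_nonneg_nonneg power_le_one) (auto intro: order_trans[rotated])
  finally show ?thesis .
qed

section \<open>Estimates for small and for large \<open>t\<close>\<close>

lemma norm_bateman_le_small:
  assumes "s \<ge> 4" "real n = s ^ 12" "0 \<le> t" "t \<le> s ^ 6"
  shows "norm (bateman n t) \<le> 2 * (3 + 2 * pi) / s"
proof -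
  have s: "0 < 1 / s" "1 / s \<le> 1 / 4"
    using assms by (auto simp: field_simps)
  \<comment> \<open>For \<open>x \<ge> 1 / s\<close> the cotangent contributes at most
    \<open>pi * s ^ 8\<close>, hence at most \<open>pi * n\<close>, to the derivative. This leaves
    at least \<open>pi * n\<close> of the linear term \<open>2 * pi * n\<close>.\<close>
  have f'_ge: "phase' n t x \<ge> s ^ 12" if x: "x \<in> {1 / s..1/2}" for x
  proof -
    have "x \<ge> 1 / s" "x \<le> 1/2" "x > 0"
      using x less_le_trans[OF s(1), of x] by auto
    then have "sin (pi * x) \<ge> 1 / s"
      using sin_pi_mult_ge[of x] by linarith
    then have "t / (sin (pi * x))\<^sup>2 \<le> t / (1 / s)\<^sup>2"
      using assms s by (intro divide_left_mono power_mono mult_pos_pos) auto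
    also have "\<dots> = t * s\<^sup>2"
      by (simp add: power_divide)
    also have "\<dots> \<le> s ^ 6 * s\<^sup>2"
      using assms by (intro mult_right_mono) auto
    also have "\<dots> = s ^ 8"
      by (simp flip: power_add)
    also have "\<dots> \<le> s ^ 12"
      using assms by (intro power_increasing) auto
    finally have "pi * (t / (sin (pi * x))\<^sup>2) \<le> pi * s ^ 12"
      by (intro mult_left_mono) auto
    moreover have "1 * s ^ 12 \<le> pi * s ^ 12"
      using pi_gt3 assms by (intro mult_right_mono) auto
    ultimately show ?thesis
      using assms(2) by (simp add: phase'_def)
  qed
  \<comment> \<open>The regularisation parameter is \<open>\<mu> = s\<close>, which makes the
    boundary and variation terms of order \<open>1 / s\<close>. The remaining integrand is at most
    \<open>1 / s\<close> pointwise once \<open>(phase' n t x)\<^sup>2\<close> exceeds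
    \<open>s ^ 3\<close>.\<close>
  have "norm (integral {1 / s..1/2} (\<lambda>x. cis (phase n t x)))
      \<le> (1 + pi) / s + integral {1 / s..1/2} (\<lambda>x. s\<^sup>2 / ((phase' n t x)\<^sup>2 + s\<^sup>2))"
  proof (rule norm_integral_cis_le)
    fix x assume x: "x \<in> {1 / s..1/2}"
    then have x': "0 < x" "x \<le> 1/2"
      using s less_le_trans[OF s(1), of x] by auto
    then show "(phase n t has_real_derivative phase' n t x) (at x within {1 / s..1/2})"
      "(phase' n t has_real_derivative phase'' t x) (at x within {1 / s..1/2})"
      by (auto intro!: has_derivative_phase has_derivative_phase')
    have "0 \<le> 4 * pi\<^sup>2 * t * (1/2 - x)"
      using x' assms by (intro mult_nonneg_nonneg) auto
    then show "0 \<le> phase'' t x"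
      using phase''_ge[OF \<open>0 \<le> t\<close> x'] by linarith
  qed (use s assms in auto)
  also have "integral {1 / s..1/2} (\<lambda>x. s\<^sup>2 / ((phase' n t x)\<^sup>2 + s\<^sup>2)) \<le> 1 / s"
  proof -
    have bd: "norm (s\<^sup>2 / ((phase' n t x)\<^sup>2 + s\<^sup>2)) \<le> 1 / s" if x: "x \<in> {1 / s..1/2}" for x
    proof -
      have "s ^ 3 \<le> s ^ 24"
        using assms by (intro power_increasing) auto
      also have "\<dots> = (s ^ 12)\<^sup>2"
        by (simp flip: power_mult)
      also have "\<dots> \<le> (phase' n t x)\<^sup>2"
        using f'_ge[OF x] assms by (intro power_mono) auto
      finally have "s ^ 3 \<le> (phase' n t x)\<^sup>2 + s\<^sup>2"
        by (simp add: add_increasing2)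
      then show ?thesis
        using assms add_nonneg_pos[of "(phase' n t x)\<^sup>2" "s\<^sup>2"]
        by (simp add: divide_simps) (simp add: power2_eq_square power3_eq_cube algebra_simps)
    qed
    have "integral {1 / s..1/2} (\<lambda>x. s\<^sup>2 / ((phase' n t x)\<^sup>2 + s\<^sup>2)) \<le> 1 / s * (1/2 - 1 / s)"
    proof -
      have "continuous_on {1 / s..1/2} (phase' n t)"
        using less_le_trans[OF s(1)] by (intro DERIV_continuous_on[OF has_derivative_phase']) auto
      then have "continuous_on {1 / s..1/2} (\<lambda>x. s\<^sup>2 / ((phase' n t x)\<^sup>2 + s\<^sup>2))"
        using assms by (intro continuous_on_square_kernel) auto
      from integral_bound[OF _ this, of "1 / s"] bd s show ?thesis
        by force
    qed
    also have "\<dots> \<le> 1 / s * 1"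
      using s by (intro mult_left_mono) linarith+
    finally show ?thesis by simp
  qed
  finally have "norm (integral {1 / s..1/2} (\<lambda>x. cis (phase n t x))) \<le> (2 + pi) / s"
    by (simp add: add_divide_distrib)
  then have "norm (integral {0..1/2} (\<lambda>x. cis (phase n t x))) \<le> (3 + pi) / s"
    using norm_integral_cis_split[OF bateman_eq_half_integrals(1)[OF \<open>0 \<le> t\<close>, of n], of "1 / s" "1/2"] s
    by (simp add: add_divide_distrib)
  \<comment> \<open>Weakened so that both ranges of \<open>t\<close> share one constant.\<close>
  also have "\<dots> \<le> (3 + 2 * pi) / s"
    using assms by (intro divide_right_mono) auto
  finally show ?thesis
    using bateman_eq_half_integrals(2)[OF \<open>0 \<le> t\<close>, of n] by linarith
qed

lemma norm_bateman_le_large: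
  assumes "s \<ge> 4" "t \<ge> s ^ 6"
  shows "norm (bateman n t) \<le> 2 * (3 + 2 * pi) / s"
proof -
  have s: "0 < 1 / s" "1 / s \<le> 1 / 4"
    using assms by (auto simp: field_simps)
  have "t \<ge> 0"
    using assms by (auto intro: order_trans[rotated])
  \<comment> \<open>Here \<open>\<mu> = s\<close> and \<open>\<kappa> = s ^ 5\<close>: at distance
    \<open>1 / s\<close> from the inflection point the second derivative is at least
    \<open>4 * pi\<^sup>2 * t / s\<close>, and \<open>t \<ge> s ^ 6\<close>.\<close>
  have "norm (integral {1 / s..1/2 - 1 / s} (\<lambda>x. cis (phase n t x))) \<le> (1 + pi) / s + pi * s / s ^ 5"
  proof (rule norm_integral_cis_le_second_derivative)
    fix x assume x: "x \<in> {1 / s..1/2 - 1 / s}"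
    then have x': "0 < x" "x \<le> 1/2"
      using less_le_trans[OF s(1), of x] s(1) by (auto simp del: zero_less_divide_iff zero_less_divide_1_iff)
    then show "(phase n t has_real_derivative phase' n t x) (at x within {1 / s..1/2 - 1 / s})"
      "(phase' n t has_real_derivative phase'' t x) (at x within {1 / s..1/2 - 1 / s})"
      by (auto intro!: has_derivative_phase has_derivative_phase')
    have "1 \<le> 4 * pi\<^sup>2"
      using one_le_power[of pi 2] pi_gt3 by linarith
    then have "1 * s ^ 5 \<le> (4 * pi\<^sup>2) * s ^ 5"
      using assms by (intro mult_right_mono) auto
    also have "\<dots> = 4 * pi\<^sup>2 * s ^ 6 * (1 / s)"
      using assms by (simp add: eval_nat_numeral)
    also have "\<dots> \<le> 4 * pi\<^sup>2 * t * (1/2 - x)"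
      using x assms s \<open>t \<ge> 0\<close> by (intro mult_mono) auto
    also have "\<dots> \<le> phase'' t x"
      by (rule phase''_ge[OF \<open>t \<ge> 0\<close> x'])
    finally show "s ^ 5 \<le> phase'' t x"
      by simp
  qed (use s assms in auto)
  also have "pi * s / s ^ 5 \<le> pi / s"
  proof -
    have "s * s \<le> s ^ 5"
      using power_increasing[of 2 5 s] assms by (simp add: power2_eq_square)
    then show ?thesis
      using assms by (simp add: field_simps)
  qed
  finally have "norm (integral {1 / s..1/2 - 1 / s} (\<lambda>x. cis (phase n t x))) \<le> (1 + 2 * pi) / s"
    by (simp add: add_divide_distrib)
  then have "norm (integral {0..1/2} (\<lambda>x. cis (phase n t x))) \<le> (3 + 2 * pi) / s"
    using norm_integral_cis_split[OF bateman_eq_half_integrals(1)[OF \<open>0 \<le> t\<close>, of n], of "1 / s" "1/2 - 1 / s"] s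
    by (simp add: add_divide_distrib)
  then show ?thesis
    using bateman_eq_half_integrals(2)[OF \<open>0 \<le> t\<close>, of n] by linarith
qed

section \<open>Combining the two ranges of \<open>t\<close>\<close>

theorem theorem4:
  shows "(\<exists>c>0::real. \<exists>N::nat. \<forall>n\<ge>N. \<forall>t>0::real.
            norm (bateman n t) < c / real n powr (1 / 12))
       \<and> (\<forall>t>0::real. (\<lambda>n. norm (bateman n t)) \<longlonglongrightarrow> 0)"
proof -
  \<comment> \<open>The threshold \<open>4 ^ 12\<close> gives \<open>s \<ge> 4\<close>, so that
    \<open>1 / s \<le> 1/2 - 1 / s\<close> and the trimmed intervals make sense. The constant 23
    comes from \<open>pi < 4\<close>, which puts \<open>2 * (3 + 2 * pi)\<close> below 22.\<close>
  have bound: "norm (bateman n t) < 23 / real n powr (1 / 12)" if n: "n \<ge> 4 ^ 12" and "t > 0" for n t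
  proof -
    define s where "s = real n powr (1 / 12)"
    have "real n \<ge> 4 ^ 12"
      using n by (metis of_nat_le_iff of_nat_numeral of_nat_power)
    then have sn: "real n = s ^ 12"
      by (simp add: s_def powr_powr flip: powr_numeral)
    then have s: "s \<ge> 4"
      using \<open>real n \<ge> 4 ^ 12\<close> power_mono_iff[of 4 s 12] by (simp add: s_def)
    have "norm (bateman n t) \<le> 2 * (3 + 2 * pi) / s"
      \<comment> \<open>The two estimates meet at \<open>t = s ^ 6\<close> and cover all positive
        \<open>t\<close>, which makes the bound uniform in \<open>t\<close>.\<close>
      using norm_bateman_le_small[OF s sn] norm_bateman_le_large[OF s] \<open>t > 0\<close> by (meson le_cases less_imp_le)
    also have "\<dots> < 23 / s"
      using pi_less_4 s by (intro divide_strict_right_mono) auto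
    finally show ?thesis
      by (simp add: s_def)
  qed
  have "(\<lambda>n. norm (bateman n t)) \<longlonglongrightarrow> 0" if "t > 0" for t
  proof (rule tendsto_sandwich[OF _ _ tendsto_const])
    show "\<forall>\<^sub>F n in sequentially. norm (bateman n t) \<le> 23 / real n powr (1 / 12)"
      using bound[OF _ that] by (intro eventually_sequentiallyI[of "4 ^ 12"] less_imp_le)
    show "(\<lambda>n. 23 / real n powr (1 / 12)) \<longlonglongrightarrow> 0"
      by real_asymp
  qed simp
  then show ?thesis
    using bound by (intro conjI exI[of _ "23::real"] exI[of _ "4 ^ 12 :: nat"]) auto
qed

end
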